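(* Let $\mathbf p$ be a poset and let $\alpha$ be a countably infinite ordinal. If the ordering of $\mathbf p$ is the intersection of a WPO ordering of length $\omega$ and a WPO ordering of length $\alpha$ (both on the vertex set of $\mathbf p$), then $\ell(\mathbf p)=\alpha$.
   Context: Orderings are partial orders, seen as sets of ordered pairs; the intersection of orderings on the same set is their set-theoretic intersection. A poset is well partially ordered (WPO) if it is well founded and has no infinite antichain; equivalently all its linear extensions are well orders. The length $\ell(\mathbf p)$ of a WPO $\mathbf p$ is the largest ordinal type of a linear extension of $\mathbf p$ (the maximum exists by de Jongh–Parikh). The length of an ordering is the length of the corresponding poset. *)

theory Defs
  imports Main "HOL-Library.Countable_Set"
begin

unbundle cardinal_syntax

text \<open>
  An ordering on a vertex set \<open>A\<close> is a reflexive relation \<open>p \<subseteq> A \<times> A\<close> with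
  \<^prop>\<open>partial_order_on A p\<close>; its strict part is \<^term>\<open>p - Id\<close>.
\<close>

definition antichain_on :: "'a set \<Rightarrow> 'a rel \<Rightarrow> 'a set \<Rightarrow> bool" where
  "antichain_on A p B \<longleftrightarrow>
     B \<subseteq> A \<and> (\<forall>x\<in>B. \<forall>y\<in>B. x \<noteq> y \<longrightarrow> (x, y) \<notin> p \<and> (y, x) \<notin> p)"

definition wpo_on :: "'a set \<Rightarrow> 'a rel \<Rightarrow> bool" where
  "wpo_on A p \<longleftrightarrow>
     partial_order_on A p \<and> wf (p - Id) \<and> \<not> (\<exists>B. antichain_on A p B \<and> infinite B)"

definition linear_extension_on :: "'a set \<Rightarrow> 'a rel \<Rightarrow> 'a rel \<Rightarrow> bool" where
  "linear_extension_on A p l \<longleftrightarrow> linear_order_on A l \<and> p \<subseteq> l"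

text \<open>
  \<open>has_length A p \<alpha>\<close>: the ordering \<open>p\<close> of \<open>A\<close> is a WPO and \<open>\<alpha>\<close> is the largest ordinal
  type of a linear extension of it. Ordinals are represented by well-order relations of an
  arbitrary type, up to the order isomorphism \<open>=o\<close>, and are compared by \<open>\<le>o\<close>. Since the length
  is given as a relation, the maximum is required to be attained, and \<open>\<alpha>\<close> is unique up to \<open>=o\<close>.
\<close>

definition has_length :: "'a set \<Rightarrow> 'a rel \<Rightarrow> 'b rel \<Rightarrow> bool" where
  "has_length A p \<alpha> \<longleftrightarrow>
     wpo_on A p \<and>
     (\<exists>l. linear_extension_on A p l \<and> l =o \<alpha>) \<and>
     (\<forall>l. linear_extension_on A p l \<longrightarrow> l \<le>o \<alpha>)"

end

theory Submission
  imports Defs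
begin

text \<open>
  Every element of a WPO \<open>q\<close> of length \<open>\<omega>\<close> is \<open>q\<close>-below all but finitely many elements: otherwise
  the infinite down-set of the elements not above it could be listed first. Let \<open>l\<close> be a linear
  extension of \<open>q \<inter> r\<close>. Then each \<open>y\<close> is \<open>r\<close>-below only finitely many elements that \<open>l\<close> puts before
  it. Order the vertices by the \<open>l\<close>-down-set generated by their \<open>r\<close>-down-sets, and break ties by a
  linear extension of \<open>r\<close>; the result \<open>m\<close> extends \<open>r\<close>. For every \<open>z\<close>, all but finitely many
  elements \<open>l\<close>-below \<open>z\<close> have their whole \<open>r\<close>-down-set \<open>l\<close>-below \<open>z\<close>, because an infinite exceptional
  set would contain an element that is \<open>r\<close>-below infinitely many other exceptional elements. Hence
  infinitely many of the elements between two limit positions of \<open>l\<close> come at corresponding places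
  of \<open>m\<close>, and the type of \<open>m\<close> is at least that of \<open>l\<close>.
\<close>

section \<open>Minimal elements and strict initial segments\<close>

lemma wf_minimal_below:
  assumes "trans p" "wf (p - Id)" "x \<in> S"
  obtains y where "y \<in> S" "y = x \<or> (y, x) \<in> p" "\<And>z. z \<in> S \<Longrightarrow> (z, y) \<in> p \<Longrightarrow> z = y"
proof -
  define T where "T = {y \<in> S. y = x \<or> (y, x) \<in> p}"
  have "x \<in> T"
    using assms(3) by (simp add: T_def)
  then obtain y where y: "y \<in> T" "\<And>z. (z, y) \<in> p - Id \<Longrightarrow> z \<notin> T"
    using wfE_min[OF assms(2)] by metis
  show thesis
  proof (rule that)
    show "y \<in> S" "y = x \<or> (y, x) \<in> p"
      using y(1) by (auto simp: T_def)
    fix z assume "z \<in> S" "(z, y) \<in> p"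
    moreover from this have "z = x \<or> (z, x) \<in> p"
      using y(1) transD[OF assms(1), of z y x] by (auto simp: T_def)
    ultimately show "z = y"
      using y(2)[of z] by (auto simp: T_def)
  qed
qed

lemma linear_order_on_underS:
  assumes "linear_order_on A l"
  shows linear_order_on_underS_asym: "x \<in> underS l y \<Longrightarrow> (y, x) \<notin> l"
    and linear_order_on_underS_trans: "(x, y) \<in> l \<Longrightarrow> y \<in> underS l z \<Longrightarrow> x \<in> underS l z"
    and linear_order_on_not_underS:
      "x \<in> A \<Longrightarrow> y \<in> A \<Longrightarrow> x \<notin> underS l y \<Longrightarrow> (y, x) \<in> l"
proof -
  have tr: "trans l" and as: "antisym l" and tot: "total_on A l" and refl: "refl_on A l"
    using assms by (auto simp: linear_order_on_def dest: partial_order_onD)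
  show asym: "x \<in> underS l y \<Longrightarrow> (y, x) \<notin> l" for x y
    using as by (auto simp: underS_def dest: antisymD)
  show "(x, y) \<in> l \<Longrightarrow> y \<in> underS l z \<Longrightarrow> x \<in> underS l z"
    using asym[of y z] transD[OF tr, of x y z] by (auto simp: underS_def)
  show "x \<in> A \<Longrightarrow> y \<in> A \<Longrightarrow> x \<notin> underS l y \<Longrightarrow> (y, x) \<in> l"
    using refl_onD[OF refl, of x] tot by (cases "x = y") (auto simp: underS_def total_on_def)
qed

section \<open>Well partial orders: finitely many minimal elements\<close>

lemma wpo_on_finite_minimals:
  assumes "wpo_on A p" "S \<subseteq> A"
  shows "finite {y \<in> S. \<forall>z\<in>S. (z, y) \<in> p \<longrightarrow> z = y}" (is "finite ?M")
proof -
  have "antichain_on A p ?M"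
    using assms(2) by (auto simp: antichain_on_def)
  thus ?thesis
    using assms(1) by (auto simp: wpo_on_def)
qed

text \<open>\<open>S\<close> is the union of the cones over its finitely many minimal elements, so
  one of these cones is infinite.\<close>

lemma wpo_on_infinite_cone:
  assumes "wpo_on A p" "S \<subseteq> A" "infinite S"
  obtains x where "x \<in> S" "infinite {y \<in> S. (x, y) \<in> p}"
proof -
  define M where "M = {y \<in> S. \<forall>z\<in>S. (z, y) \<in> p \<longrightarrow> z = y}"
  have refl: "refl_on A p" and "trans p" "wf (p - Id)"
    using assms(1) by (auto simp: wpo_on_def dest: partial_order_onD)
  have "S \<subseteq> (\<Union>x\<in>M. {y \<in> S. (x, y) \<in> p})"
  proof
    fix y assume "y \<in> S"
    then obtain x where "x \<in> S" "x = y \<or> (x, y) \<in> p" "\<And>z. z \<in> S \<Longrightarrow> (z, x) \<in> p \<Longrightarrow> z = x"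
      using wf_minimal_below[OF \<open>trans p\<close> \<open>wf (p - Id)\<close>] by metis
    moreover have "(y, y) \<in> p"
      using refl \<open>y \<in> S\<close> assms(2) by (auto simp: refl_on_def)
    ultimately show "y \<in> (\<Union>x\<in>M. {y \<in> S. (x, y) \<in> p})"
      using \<open>y \<in> S\<close> by (auto simp: M_def)
  qed
  moreover have "finite M"
    unfolding M_def using wpo_on_finite_minimals assms(1,2) by blast
  ultimately obtain x where "x \<in> M" "infinite {y \<in> S. (x, y) \<in> p}"
    using assms(3) finite_subset by (metis (no_types, lifting) finite_UN_I)
  thus thesis
    using that by (auto simp: M_def)
qed

text \<open>The \<open>p\<close>-minimal elements of a nonempty set are finite in number, and the
  \<open>l\<close>-least of them is \<open>l\<close>-least in the whole set: every element has a
  \<open>p\<close>-minimal one below it, and \<open>l\<close> extends \<open>p\<close>.\<close>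

lemma linear_extension_on_well_order_on:
  assumes "wpo_on A p" "linear_extension_on A p l"
  shows "well_order_on A l"
proof -
  have lin: "linear_order_on A l" and sub: "p \<subseteq> l"
    using assms(2) by (auto simp: linear_extension_on_def)
  have tr: "trans l" and as: "antisym l" and lA: "l \<subseteq> A \<times> A"
    using lin by (auto simp: linear_order_on_def dest: partial_order_onD)
  have "trans p" "wf (p - Id)"
    using assms(1) by (auto simp: wpo_on_def dest: partial_order_onD)
  have "wf (l - Id)"
  proof (rule wfI_min)
    fix x :: 'a and Q assume "x \<in> Q"
    show "\<exists>z\<in>Q. \<forall>y. (y, z) \<in> l - Id \<longrightarrow> y \<notin> Q"
    proof (cases "x \<in> A")
      case False
      thus ?thesis
        using \<open>x \<in> Q\<close> lA by blast
    next
      case True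
      define S where "S = Q \<inter> A"
      define M where "M = {y \<in> S. \<forall>z\<in>S. (z, y) \<in> p \<longrightarrow> z = y}"
      have below: "\<exists>z\<in>M. z = y \<or> (z, y) \<in> p" if "y \<in> S" for y
      proof -
        obtain z where "z \<in> S" "z = y \<or> (z, y) \<in> p" "\<And>u. u \<in> S \<Longrightarrow> (u, z) \<in> p \<Longrightarrow> u = z"
          by (rule wf_minimal_below[OF \<open>trans p\<close> \<open>wf (p - Id)\<close> \<open>y \<in> S\<close>]) blast
        thus ?thesis
          by (auto simp: M_def)
      qed
      have "finite M"
        unfolding M_def by (rule wpo_on_finite_minimals[OF assms(1)]) (simp add: S_def)
      moreover have "M \<noteq> {}"
        using below \<open>x \<in> Q\<close> True by (auto simp: S_def)
      moreover have "acyclic (l - Id)"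
        using lin by (rule linear_order_on_acyclic)
      ultimately obtain m where m: "m \<in> M" "\<And>y. (y, m) \<in> l - Id \<Longrightarrow> y \<notin> M"
      proof -
        have "wf ((l - Id) \<inter> M \<times> M)"
          using \<open>finite M\<close> \<open>acyclic (l - Id)\<close>
          by (intro finite_acyclic_wf) (auto intro: acyclic_subset)
        then obtain m where "m \<in> M" "\<And>y. (y, m) \<in> (l - Id) \<inter> M \<times> M \<Longrightarrow> y \<notin> M"
          using \<open>M \<noteq> {}\<close> wfE_min by (metis equals0I)
        thus ?thesis
          using that by blast
      qed
      have "y \<notin> Q" if "(y, m) \<in> l - Id" for y
      proof
        assume "y \<in> Q"
        hence "y \<in> S"
          using that lA by (auto simp: S_def)
        then obtain z where z: "z \<in> M" "z = y \<or> (z, y) \<in> p"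
          using below by blast
        hence zm: "(z, m) \<in> l"
          using that sub transD[OF tr, of z y m] by auto
        hence "z = m"
          using m(2) z(1) by auto
        thus False
          using z(2) that sub antisymD[OF as, of m y] by auto
      qed
      thus ?thesis
        using m(1) by (auto simp: M_def S_def)
    qed
  qed
  thus ?thesis
    using lin by (simp add: well_order_on_def)
qed

section \<open>Linear extensions sorted by a key\<close>

text \<open>The key type is merely partially ordered, so that keys can be truth values as well as
  sets under inclusion; comparability is demanded on \<open>A\<close> alone.\<close>

lemma linear_extension_on_lex:
  fixes key :: "'a \<Rightarrow> 'c::order"
  assumes "linear_extension_on A r s"
    and total: "\<And>x y. x \<in> A \<Longrightarrow> y \<in> A \<Longrightarrow> key x \<le> key y \<or> key y \<le> key x"
    and mono: "\<And>x y. (x, y) \<in> r \<Longrightarrow> key x \<le> key y"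
  shows "linear_extension_on A r
           {(x, y). x \<in> A \<and> y \<in> A \<and> (key x < key y \<or> key x = key y \<and> (x, y) \<in> s)}"
    (is "linear_extension_on A r ?m")
proof -
  have sA: "s \<subseteq> A \<times> A" and refl: "refl_on A s" and tr: "trans s" and as: "antisym s"
    and tot: "total_on A s" and sub: "r \<subseteq> s"
    using assms(1) by (auto simp: linear_extension_on_def linear_order_on_def dest: partial_order_onD)
  have "refl_on A ?m"
    using refl by (auto simp: refl_on_def)
  moreover have "trans ?m"
  proof (rule transI)
    fix x y z assume "(x, y) \<in> ?m" "(y, z) \<in> ?m"
    thus "(x, z) \<in> ?m"
      using transD[OF tr, of x y z] less_trans[of "key x" "key y" "key z"] by auto
  qed
  moreover have "antisym ?m"
  proof (rule antisymI)
    fix x y assume "(x, y) \<in> ?m" "(y, x) \<in> ?m"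
    thus "x = y"
      using antisymD[OF as, of x y] less_not_sym[of "key x" "key y"] by auto
  qed
  moreover have "total_on A ?m"
  proof (rule total_onI)
    fix x y assume "x \<in> A" "y \<in> A" "x \<noteq> y"
    thus "(x, y) \<in> ?m \<or> (y, x) \<in> ?m"
      using total[of x y] tot by (auto simp: total_on_def order.order_iff_strict)
  qed
  moreover have "r \<subseteq> ?m"
  proof
    fix e assume "e \<in> r"
    thus "e \<in> ?m"
      using mono[of "fst e" "snd e"] sub sA by (cases e) (auto simp: order.order_iff_strict)
  qed
  ultimately show ?thesis
    by (auto simp: linear_extension_on_def linear_order_on_def partial_order_on_def preorder_on_def)
qed

section \<open>Orderings of length \<omega>\<close>

lemma ordLeq_natLeq_finite_under:
  assumes "m \<le>o natLeq" "x \<in> Field m"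
  shows "finite (under m x)"
proof -
  obtain f where "embed m natLeq f"
    using assms(1) by (auto simp: ordLeq_def)
  hence "bij_betw f (under m x) (under natLeq (f x))"
    using assms(2) by (auto simp: embed_def)
  moreover have "finite (under natLeq (f x))"
    by (auto simp: under_def natLeq_def)
  ultimately show ?thesis
    by (simp add: bij_betw_finite)
qed

lemma has_length_natLeq_finite_not_above:
  assumes "has_length A q natLeq" "x \<in> A"
  shows "finite {y \<in> A. (x, y) \<notin> q}" (is "finite ?D")
proof -
  obtain s where s: "linear_extension_on A q s"
    and max: "\<And>l. linear_extension_on A q l \<Longrightarrow> l \<le>o natLeq"
    using assms(1) by (auto simp: has_length_def)
  have refl: "refl_on A q" and tr: "trans q" and qA: "q \<subseteq> A \<times> A"
    using assms(1) by (auto simp: has_length_def wpo_on_def dest: partial_order_onD)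
  \<comment> \<open>The key is the truth value of \<open>(x, y) \<in> q\<close>. As False is less
    than True, the elements not above \<open>x\<close> come first; transitivity of \<open>q\<close>
    makes the key monotone.\<close>
  define m where "m = {(y, z). y \<in> A \<and> z \<in> A \<and>
      (((x, y) \<in> q) < ((x, z) \<in> q) \<or> ((x, y) \<in> q) = ((x, z) \<in> q) \<and> (y, z) \<in> s)}"
  have "linear_extension_on A q m"
    unfolding m_def using s by (rule linear_extension_on_lex) (use transD[OF tr] in \<open>auto simp: le_bool_def\<close>)
  hence "m \<le>o natLeq"
    by (rule max)
  moreover have "(x, x) \<in> q"
    using refl assms(2) by (auto simp: refl_on_def)
  hence "(y, x) \<in> m" if "y \<in> ?D" for y
    using that assms(2) by (auto simp: m_def)
  hence "?D \<subseteq> under m x"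
    by (auto simp: under_def)
  moreover have "x \<in> Field m"
    using \<open>linear_extension_on A q m\<close> assms(2)
    by (auto simp: linear_extension_on_def linear_order_on_def partial_order_on_def
        preorder_on_def refl_on_def Field_def)
  ultimately show ?thesis
    using ordLeq_natLeq_finite_under by (metis finite_subset)
qed

text \<open>Some \<open>x\<close> in an infinite antichain \<open>B\<close> of the intersection
  would be \<open>r\<close>-below infinitely many members of \<open>B\<close>. Apart from
  \<open>x\<close>, none of these is \<open>q\<close>-above \<open>x\<close>, but only finitely many
  elements fail to be.\<close>

lemma wpo_on_Int:
  assumes "partial_order_on A (q \<inter> r)" "wpo_on A q" "wpo_on A r" "has_length A q natLeq"
  shows "wpo_on A (q \<inter> r)"
proof -
  have "wf (q \<inter> r - Id)"
    using assms(2) by (auto simp: wpo_on_def intro: wf_subset)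
  moreover have False if B: "antichain_on A (q \<inter> r) B" "infinite B" for B
  proof -
    have "B \<subseteq> A"
      using B by (auto simp: antichain_on_def)
    then obtain x where x: "x \<in> B" "infinite {y \<in> B. (x, y) \<in> r}"
      using wpo_on_infinite_cone[OF assms(3)] B(2) by metis
    have "{y \<in> B. (x, y) \<in> r} \<subseteq> insert x {y \<in> A. (x, y) \<notin> q}"
      using B(1) x(1) by (auto simp: antichain_on_def)
    moreover have "finite {y \<in> A. (x, y) \<notin> q}"
      by (rule has_length_natLeq_finite_not_above[OF assms(4)]) (use x(1) \<open>B \<subseteq> A\<close> in blast)
    ultimately show False
      using x(2) finite_subset[of "{y \<in> B. (x, y) \<in> r}"] by simp
  qed
  ultimately show ?thesis
    using assms(1) unfolding wpo_on_def by blast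
qed

section \<open>Comparing two well orders along limit positions\<close>

text \<open>
  A position \<open>w\<close> counts as a limit if no earlier position is finitely many steps away from it;
  in particular the least element does.
\<close>

lemma well_order_on_ordLeqI:
  assumes l: "well_order_on A l" and m: "well_order_on A m"
    and down: "\<And>x y z. x \<in> M z \<Longrightarrow> (y, x) \<in> m \<Longrightarrow> y \<in> M z"
    and M_sub: "\<And>z. z \<in> A \<Longrightarrow> M z \<subseteq> underS l z"
    and M_fin: "\<And>z. z \<in> A \<Longrightarrow> finite (underS l z - M z)"
  shows "l \<le>o m"
proof (rule ccontr)
  assume "\<not> l \<le>o m"
  have wl: "Well_order l" "Field l = A" and wm: "Well_order m" "Field m = A"
    using l m well_order_on_Well_order by blast+
  have lA: "l \<subseteq> A \<times> A" and refl: "refl_on A l" and tr: "trans l" and wf: "wf (l - Id)"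
    using l by (auto simp: well_order_on_def linear_order_on_def dest: partial_order_onD)
  have lin: "linear_order_on A l"
    using l by (simp add: well_order_on_def)
  note asym = linear_order_on_underS_asym[OF lin]
    and underS_trans = linear_order_on_underS_trans[OF lin]
    and not_underS = linear_order_on_not_underS[OF lin]
  have "m <o l"
    using \<open>\<not> l \<le>o m\<close> wl wm not_ordLeq_iff_ordLess by blast
  \<comment> \<open>If \<open>m\<close> is shorter, it is a proper initial segment of
    \<open>l\<close> up to isomorphism; \<open>g\<close> below is that isomorphism.\<close>
  then obtain c where c: "c \<in> A" "m =o Restr l (underS l c)"
    using ordLess_iff_ordIso_Restr wl wm by blast
  have "wo_rel.ofilter l (underS l c)"
    using wl(1) by (simp add: wo_rel_def wo_rel.underS_ofilter)
  hence "Field (Restr l (underS l c)) = underS l c"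
    using wl(1) Field_Restr_ofilter by blast
  then obtain g where g: "bij_betw g A (underS l c)"
    "\<And>x y. x \<in> A \<Longrightarrow> y \<in> A \<Longrightarrow> (x, y) \<in> m \<longleftrightarrow> (g x, g y) \<in> Restr l (underS l c)"
    using c(2) wm(2) by (auto simp: ordIso_def iso_iff2)
  have g_img: "g ` A = underS l c" and g_inj: "inj_on g A"
    using g(1) by (auto simp: bij_betw_def)
  \<comment> \<open>The intervals are half-open, so that those from \<open>v\<close> to
    \<open>w\<close> and from \<open>w\<close> to \<open>y\<close> join up exactly.\<close>
  define btw where "btw w y = {u. (w, u) \<in> l \<and> u \<in> underS l y}" for w y
  define lim where "lim w \<longleftrightarrow> w \<in> A \<and> (\<forall>v \<in> underS l w. infinite (btw v w))" for w
  have lim_below: "\<exists>w. lim w \<and> (w, y) \<in> l \<and> finite (btw w y)" if "y \<in> A" for y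
  proof -
    \<comment> \<open>The least position finitely many steps below \<open>y\<close> is a limit: a
      position finitely far below it would also be finitely far below \<open>y\<close>.\<close>
    define W where "W = {w. (w, y) \<in> l \<and> finite (btw w y)}"
    have "btw y y = {}"
      using asym by (auto simp: btw_def)
    hence "y \<in> W"
      using refl that by (auto simp: W_def refl_on_def)
    then obtain w where w: "w \<in> W" "\<And>v. (v, w) \<in> l - Id \<Longrightarrow> v \<notin> W"
      using wfE_min[OF wf] by metis
    have "infinite (btw v w)" if v: "v \<in> underS l w" for v
    proof
      assume "finite (btw v w)"
      moreover have "btw v y \<subseteq> btw v w \<union> btw w y"
      proof
        fix u assume u: "u \<in> btw v y"
        hence "u \<in> A" "w \<in> A"
          using lA w(1) by (auto simp: btw_def W_def)
        thus "u \<in> btw v w \<union> btw w y"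
          using u not_underS[of u w] by (auto simp: btw_def)
      qed
      ultimately have "finite (btw v y)"
        using w(1) finite_subset[of "btw v y" "btw v w \<union> btw w y"] by (simp add: W_def)
      moreover have "(v, y) \<in> l"
        using v w(1) transD[OF tr, of v w y] by (auto simp: underS_def W_def)
      ultimately show False
        using w(2)[of v] v by (auto simp: W_def underS_def)
    qed
    thus ?thesis
      using w(1) lA by (auto simp: lim_def W_def)
  qed
  \<comment> \<open>Once the image of \<open>M w\<close> fills everything below \<open>w\<close>,
    injectivity sends all other elements to \<open>w\<close> or beyond.\<close>
  have not_below: "(w, g x) \<in> l" if "underS l w \<subseteq> g ` M w" "w \<in> A" "x \<in> A" "x \<notin> M w" for w x
  proof -
    have "M w \<subseteq> A"
      using M_sub[OF that(2)] lA by (auto simp: underS_def)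
    hence "g x \<notin> g ` M w"
      using g_inj that by (auto simp: inj_on_def)
    hence "g x \<notin> underS l w"
      using that by blast
    moreover have "g x \<in> A"
      using g_img that lA by (auto simp: underS_def)
    ultimately show ?thesis
      using not_underS that(2) by blast
  qed
  \<comment> \<open>Induction along \<open>l\<close>. As \<open>M z\<close> is closed downwards in
    \<open>m\<close>, it suffices to find some \<open>x\<close> in \<open>M z\<close> whose image is
    at or beyond \<open>y\<close>.\<close>
  have covered: "lim z \<longrightarrow> underS l z \<subseteq> g ` M z" for z
  proof (induction z rule: wf_induct_rule[OF wf])
    case (1 z)
    show ?case
    proof (intro impI subsetI)
      fix y assume z: "lim z" and y: "y \<in> underS l z"
      hence "y \<in> A" "z \<in> A"
        using lA by (auto simp: underS_def)
      then obtain w where w: "lim w" "(w, y) \<in> l" "finite (btw w y)"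
        using lim_below by blast
      have wz: "w \<in> underS l z"
        using w(2) y by (rule underS_trans)
      hence IH: "underS l w \<subseteq> g ` M w"
        using "1.IH"[of w] w(1) by (auto simp: underS_def)
      have "infinite (btw w z)"
        using z wz by (auto simp: lim_def)
      moreover have "btw w z \<subseteq> (btw w z \<inter> M z) \<union> (underS l z - M z)"
        by (auto simp: btw_def)
      ultimately have "infinite (btw w z \<inter> M z)"
        using M_fin[OF \<open>z \<in> A\<close>] by (metis finite_subset finite_UnI)
      moreover have "inj_on g (btw w z \<inter> M z)"
        using g_inj by (rule inj_on_subset) (use lA in \<open>auto simp: btw_def\<close>)
      ultimately have "infinite (g ` (btw w z \<inter> M z))"
        by (simp add: finite_image_iff)
      \<comment> \<open>Infinitely many images do not fit into the finite interval from
        \<open>w\<close> to \<open>y\<close>. Since \<open>x\<close> lies outside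
        \<open>M w\<close>, its image is not before \<open>w\<close>, so it must be at or beyond
        \<open>y\<close>.\<close>
      then obtain x where x: "x \<in> btw w z" "x \<in> M z" "g x \<notin> btw w y"
        using w(3) finite_subset[of "g ` (btw w z \<inter> M z)" "btw w y"] by blast
      have "x \<in> A"
        using x(1) lA by (auto simp: btw_def)
      have "w \<in> A"
        using w(1) by (simp add: lim_def)
      hence "x \<notin> M w"
        using x(1) M_sub[of w] asym[of x w] by (auto simp: btw_def)
      hence "(w, g x) \<in> l"
        using not_below IH \<open>w \<in> A\<close> \<open>x \<in> A\<close> by blast
      hence "g x \<notin> underS l y"
        using x(3) by (auto simp: btw_def)
      moreover have gx: "g x \<in> underS l c"
        using g_img \<open>x \<in> A\<close> by blast
      hence "g x \<in> A"
        using lA by (auto simp: underS_def)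
      ultimately have yg: "(y, g x) \<in> l"
        using not_underS \<open>y \<in> A\<close> by blast
      \<comment> \<open>The range of \<open>g\<close> is an initial segment of \<open>l\<close>, so
        \<open>y\<close> has a preimage, and this precedes \<open>x\<close> in
        \<open>m\<close>.\<close>
      hence "y \<in> underS l c"
        using gx by (rule underS_trans)
      then obtain x' where x': "x' \<in> A" "y = g x'"
        using g_img by blast
      hence "(x', x) \<in> m"
        using g(2) \<open>x \<in> A\<close> yg gx \<open>y \<in> underS l c\<close> by blast
      thus "y \<in> g ` M z"
        using down x(2) x'(2) by blast
    qed
  qed
  obtain w where w: "lim w" "(w, c) \<in> l" "finite (btw w c)"
    using lim_below[OF c(1)] by blast
  have "w \<in> A"
    using w(1) by (simp add: lim_def)
  \<comment> \<open>Pigeonhole: the interval from \<open>w\<close> to \<open>c\<close> with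
    \<open>c\<close> included would be mapped injectively into the finite one without
    \<open>c\<close>, because \<open>g\<close> has all its values below \<open>c\<close>.\<close>
  have "g ` (insert c (btw w c)) \<subseteq> btw w c"
  proof
    fix t assume "t \<in> g ` (insert c (btw w c))"
    then obtain x where x: "t = g x" "(w, x) \<in> l"
      using w(2) by (auto simp: btw_def)
    have "x \<in> A"
      using x(2) lA by auto
    moreover have "x \<notin> M w"
      using x(2) M_sub[OF \<open>w \<in> A\<close>] asym[of x w] by auto
    ultimately show "t \<in> btw w c"
      using not_below[of w x] covered w(1) \<open>w \<in> A\<close> x(1) g_img by (auto simp: btw_def)
  qed
  moreover have "inj_on g (insert c (btw w c))"
    using g_inj by (rule inj_on_subset) (use lA c(1) in \<open>auto simp: btw_def\<close>)
  moreover have "c \<notin> btw w c"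
    by (auto simp: btw_def underS_def)
  ultimately show False
    using w(3) card_inj_on_le[of g "insert c (btw w c)" "btw w c"] by simp
qed

section \<open>Linear extensions of the intersection\<close>

lemma linear_extension_on_Int_ordLeq:
  assumes q: "has_length A q natLeq" and r: "wpo_on A r"
    and s: "linear_extension_on A r s"
    and p: "wpo_on A (q \<inter> r)" and l: "linear_extension_on A (q \<inter> r) l"
  obtains m where "linear_extension_on A r m" "l \<le>o m"
proof -
  have wl: "well_order_on A l"
    using linear_extension_on_well_order_on p l by blast
  have lA: "l \<subseteq> A \<times> A" and refl: "refl_on A l" and tr: "trans l"
    and tot: "total_on A l" and sub: "q \<inter> r \<subseteq> l"
    using l by (auto simp: linear_extension_on_def linear_order_on_def dest: partial_order_onD)
  have lin: "linear_order_on A l"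
    using l by (simp add: linear_extension_on_def)
  have r_refl: "refl_on A r" and r_tr: "trans r" and rA: "r \<subseteq> A \<times> A"
    using r by (auto simp: wpo_on_def dest: partial_order_onD)
  \<comment> \<open>Down-sets of the linear order \<open>l\<close> are comparable under inclusion,
    and going up in \<open>r\<close> enlarges the \<open>r\<close>-down-set, so the key is total and
    monotone.\<close>
  define key where "key x = {z. \<exists>y. (y, x) \<in> r \<and> (z, y) \<in> l}" for x
  define m where "m = {(x, y). x \<in> A \<and> y \<in> A \<and> (key x < key y \<or> key x = key y \<and> (x, y) \<in> s)}"
  have m: "linear_extension_on A r m"
    unfolding m_def using s
  proof (rule linear_extension_on_lex)
    fix x y assume "x \<in> A" "y \<in> A"
    show "key x \<le> key y \<or> key y \<le> key x"
    proof (rule ccontr)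
      assume "\<not> (key x \<le> key y \<or> key y \<le> key x)"
      then obtain u v where u: "u \<in> key x" "u \<notin> key y" and v: "v \<in> key y" "v \<notin> key x"
        by blast
      have "u \<in> A" "v \<in> A"
        using u(1) v(1) lA by (auto simp: key_def)
      hence "(u, v) \<in> l \<or> (v, u) \<in> l"
        using tot u v by (auto simp: total_on_def)
      thus False
        using u v transD[OF tr] unfolding key_def by blast
    qed
  next
    fix x y assume "(x, y) \<in> r"
    thus "key x \<le> key y"
      using transD[OF r_tr] unfolding key_def by blast
  qed
  \<comment> \<open>Equivalently, \<open>key x\<close> is contained in \<open>underS l z\<close>;
    going down in \<open>m\<close> shrinks the key or keeps it, hence stays inside
    \<open>M z\<close>.\<close>
  define M where "M z = {x \<in> A. \<forall>y. (y, x) \<in> r \<longrightarrow> y \<in> underS l z}" for z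
  have "l \<le>o m"
  proof (rule well_order_on_ordLeqI[where M = M, OF wl])
    show "well_order_on A m"
      using linear_extension_on_well_order_on r m by blast
  next
    fix x y z assume x: "x \<in> M z" and yx: "(y, x) \<in> m"
    have "t \<in> underS l z" if "(t, y) \<in> r" for t
    proof -
      have "(t, t) \<in> l"
        using that rA refl by (auto simp: refl_on_def)
      hence "t \<in> key y"
        using that by (auto simp: key_def)
      hence "t \<in> key x"
        using yx by (auto simp: m_def)
      then obtain t' where "(t', x) \<in> r" "(t, t') \<in> l"
        by (auto simp: key_def)
      moreover from this have "t' \<in> underS l z"
        using x by (auto simp: M_def)
      ultimately show ?thesis
        using linear_order_on_underS_trans[OF lin] by blast
    qed
    thus "y \<in> M z"
      using yx by (auto simp: M_def m_def)
  next
    fix z assume "z \<in> A"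
    show "M z \<subseteq> underS l z"
      using r_refl by (auto simp: M_def refl_on_def)
    show "finite (underS l z - M z)"
    proof (rule ccontr)
      assume inf: "infinite (underS l z - M z)"
      have "underS l z - M z \<subseteq> A"
        using lA by (auto simp: underS_def)
      then obtain x where x: "x \<in> underS l z - M z"
        "infinite {x' \<in> underS l z - M z. (x, x') \<in> r}"
        using wpo_on_infinite_cone[OF r] inf by metis
      have "x \<in> A"
        using x(1) lA by (auto simp: underS_def)
      \<comment> \<open>This \<open>y\<close> is \<open>r\<close>-below the whole cone over
        \<open>x\<close>, yet \<open>l\<close> puts it at or after \<open>z\<close> and the
        exceptional elements before \<open>z\<close>. So \<open>y\<close> is \<open>q\<close>-below
        none of the infinitely many exceptional elements in the cone.\<close>
      then obtain y where y: "(y, x) \<in> r" "y \<notin> underS l z"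
        using x(1) by (auto simp: M_def)
      have "y \<in> A"
        using y(1) rA by blast
      hence zy: "(z, y) \<in> l"
        using y(2) linear_order_on_not_underS[OF lin] \<open>z \<in> A\<close> by blast
      have "{x' \<in> underS l z - M z. (x, x') \<in> r} \<subseteq> {x' \<in> A. (y, x') \<notin> q}"
      proof safe
        fix x' assume x': "x' \<in> underS l z" "(x, x') \<in> r"
        thus "x' \<in> A"
          using rA by blast
        assume "(y, x') \<in> q"
        moreover have "(y, x') \<in> r"
          using r_tr y(1) x'(2) by (rule transD)
        ultimately have "(y, x') \<in> l"
          using sub by blast
        thus False
          using linear_order_on_underS_asym[OF lin x'(1)] transD[OF tr zy] by blast
      qed
      hence "finite {x' \<in> underS l z - M z. (x, x') \<in> r}"
        by (rule finite_subset) (rule has_length_natLeq_finite_not_above[OF q \<open>y \<in> A\<close>])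
      thus False
        using x(2) by contradiction
    qed
  qed
  thus thesis
    using that m by blast
qed

theorem corollary1p2:
  fixes A :: "'a set" and p q r :: "'a rel" and \<alpha> :: "'b rel"
  assumes "partial_order_on A p"
    and "Well_order \<alpha>" and "countable (Field \<alpha>)" and "infinite (Field \<alpha>)"
    and "wpo_on A q" and "has_length A q natLeq"
    and "wpo_on A r" and "has_length A r \<alpha>"
    and "p = q \<inter> r"
  shows "has_length A p \<alpha>"
proof -
  have p: "wpo_on A (q \<inter> r)"
    using wpo_on_Int assms by blast
  obtain s where s: "linear_extension_on A r s" "s =o \<alpha>"
    and max: "\<And>m. linear_extension_on A r m \<Longrightarrow> m \<le>o \<alpha>"
    using assms(8) by (auto simp: has_length_def)
  \<comment> \<open>The type \<alpha> is attained because a linear extension of \<open>r\<close>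
    also extends the smaller relation \<open>p\<close>.\<close>
  have "linear_extension_on A p s"
    using s(1) assms(9) by (auto simp: linear_extension_on_def)
  moreover have "l \<le>o \<alpha>" if "linear_extension_on A p l" for l
  proof -
    have "linear_extension_on A (q \<inter> r) l"
      using that assms(9) by simp
    then obtain m where "linear_extension_on A r m" "l \<le>o m"
      by (rule linear_extension_on_Int_ordLeq[OF assms(6,7) s(1) p])
    thus ?thesis
      using max ordLeq_transitive by blast
  qed
  ultimately show ?thesis
    using p s(2) assms(9) by (auto simp: has_length_def)
qed

end
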